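(* Let $X$ be a real Hilbert space, let $A_1$ and $A_2$ be two maximally monotone (set-valued) operators from $X$ to $X$, and assume that one of these is both at most single-valued and strictly monotone. Denote the resolvents of $A_1$ and $A_2$ by $T_1$ and $T_2$, respectively. Then the operator governing the Douglas-Rachford iteration, i.e., $$T:=\tfrac12(2T_1-\mathrm{Id})(2T_2-\mathrm{Id})+\tfrac12\mathrm{Id},$$ is not just firmly nonexpansive but also strictly nonexpansive; consequently, $\operatorname{Fix}T$ is either empty or a singleton.
   Context: $X$ is a real Hilbert space; $\mathrm{Id}$ is the identity on $X$; products of mappings denote composition. $T\colon X\to X$ is firmly nonexpansive if $\|Tx-Ty\|^2+\|(\mathrm{Id}-T)x-(\mathrm{Id}-T)y\|^2\leq\|x-y\|^2$ for all $x,y\in X$; it is strictly nonexpansive if $x\neq y\Rightarrow\|Tx-Ty\|<\|x-y\|$ for all $x,y\in X$. $\operatorname{Fix}T=\{x\in X:x=Tx\}$. For $A\colon X\rightrightarrows X$ (so $Ax\subseteq X$ for each $x$): $\operatorname{gr}A=\{(x,u):u\in Ax\}$. $A$ is at most single-valued if each $Ax$ has at most one element. $A$ is monotone if $\langle x-y,u-v\rangle\geq0$ for all $(x,u),(y,v)\in\operatorname{gr}A$; strictly monotone if $\langle x-y,u-v\rangle>0$ whenever $(x,u),(y,v)\in\operatorname{gr}A$ and $x\neq y$; maximally monotone if it is monotone with no proper monotone extension. The resolvent of a maximally monotone $A$ is $J_A=(\mathrm{Id}+A)^{-1}\colon X\to X$. *)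

theory Defs
  imports "HOL-Analysis.Analysis"
begin

text \<open>
  A set-valued operator on a type \<open>'a\<close> is a function \<open>'a \<Rightarrow> 'a set\<close>. A real Hilbert
  space is a type of sort \<open>{real_inner, complete_space}\<close>.
\<close>

definition gr :: "('a \<Rightarrow> 'a set) \<Rightarrow> ('a \<times> 'a) set" where
  "gr A = {(x, u). u \<in> A x}"

definition at_most_single_valued :: "('a \<Rightarrow> 'a set) \<Rightarrow> bool" where
  "at_most_single_valued A \<longleftrightarrow> (\<forall>x. \<forall>u\<in>A x. \<forall>v\<in>A x. u = v)"

definition monotone_op :: "('a::real_inner \<Rightarrow> 'a set) \<Rightarrow> bool" where
  "monotone_op A \<longleftrightarrow>
    (\<forall>x u y v. (x, u) \<in> gr A \<longrightarrow> (y, v) \<in> gr A \<longrightarrow> (x - y) \<bullet> (u - v) \<ge> 0)"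

definition strictly_monotone_op :: "('a::real_inner \<Rightarrow> 'a set) \<Rightarrow> bool" where
  "strictly_monotone_op A \<longleftrightarrow>
    (\<forall>x u y v. (x, u) \<in> gr A \<longrightarrow> (y, v) \<in> gr A \<longrightarrow> x \<noteq> y \<longrightarrow> (x - y) \<bullet> (u - v) > 0)"

definition maximally_monotone_op :: "('a::real_inner \<Rightarrow> 'a set) \<Rightarrow> bool" where
  "maximally_monotone_op A \<longleftrightarrow>
    monotone_op A \<and> \<not> (\<exists>B. monotone_op B \<and> gr A \<subset> gr B)"

definition id_op :: "'a \<Rightarrow> 'a set" where
  "id_op x = {x}"

definition sum_op :: "('a::plus \<Rightarrow> 'a set) \<Rightarrow> ('a \<Rightarrow> 'a set) \<Rightarrow> 'a \<Rightarrow> 'a set" where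
  "sum_op A B x = {u + v | u v. u \<in> A x \<and> v \<in> B x}"

definition inverse_op :: "('a \<Rightarrow> 'a set) \<Rightarrow> 'a \<Rightarrow> 'a set" where
  "inverse_op A u = {x. u \<in> A x}"

text \<open>
  By Minty's theorem, \<open>(Id + A)\<inverse> x\<close> is a singleton for every \<open>x\<close> when \<open>A\<close> is maximally
  monotone on a Hilbert space; the resolvent is read as the point-valued map. For operators
  where this set is not a singleton the value is unspecified.
\<close>

definition resolvent :: "('a::real_inner \<Rightarrow> 'a set) \<Rightarrow> 'a \<Rightarrow> 'a" where
  "resolvent A x = the_elem (inverse_op (sum_op id_op A) x)"

definition firmly_nonexpansive :: "('a::real_inner \<Rightarrow> 'a) \<Rightarrow> bool" where
  "firmly_nonexpansive T \<longleftrightarrow>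
    (\<forall>x y. (norm (T x - T y))\<^sup>2 + (norm ((x - T x) - (y - T y)))\<^sup>2 \<le> (norm (x - y))\<^sup>2)"

definition strictly_nonexpansive :: "('a::real_inner \<Rightarrow> 'a) \<Rightarrow> bool" where
  "strictly_nonexpansive T \<longleftrightarrow> (\<forall>x y. x \<noteq> y \<longrightarrow> norm (T x - T y) < norm (x - y))"

definition Fix :: "('a \<Rightarrow> 'a) \<Rightarrow> 'a set" where
  "Fix T = {x. x = T x}"

end

theory Submission
  imports Defs
begin

text \<open>
  Writing \<open>u = x - J x\<close> for the element of \<open>A (J x)\<close> selected by the resolvent, the reflected
  resolvent \<open>R = 2 J - Id\<close> satisfies
  \<open>\<parallel>R x - R y\<parallel>\<^sup>2 = \<parallel>x - y\<parallel>\<^sup>2 - 4 \<langle>J x - J y, u - v\<rangle>\<close>, so it is nonexpansive, and strictly so if \<open>A\<close>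
  is single-valued and strictly monotone. Strictness of one factor passes to \<open>R\<^sub>1 R\<^sub>2\<close> and to its
  average with the identity.

  That \<open>J\<close> is everywhere defined is Minty's theorem, obtained here from the Fitzpatrick function
  \<open>F (x, u) = sup {\<langle>x, v\<rangle> + \<langle>a, u\<rangle> - \<langle>a, v\<rangle> | (a, v) \<in> gr A}\<close>, which dominates the duality product by
  maximality: if \<open>(x, u)\<close> minimises \<open>F + \<parallel>\<cdot>\<parallel>\<^sup>2/2\<close>, the optimality condition forces \<open>u = - x\<close> and
  \<open>u \<in> A x\<close>.
\<close>

section \<open>Minimisation over epigraphs\<close>

text \<open>
  Extended-valued convex functions are replaced by their epigraphs \<open>P\<close>, so that the conclusion
  is the optimality condition of minimising \<open>t + \<parallel>z\<parallel>\<^sup>2/2\<close> over \<open>P\<close>.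
\<close>

lemma epigraph_quadratic_minimiser:
  fixes P :: "('b::{real_inner, complete_space} \<times> real) set"
  assumes "closed P" "convex P" "P \<noteq> {}"
    and bound: "\<And>z t. (z, t) \<in> P \<Longrightarrow> c \<le> t + z \<bullet> z / 2"
  obtains z0 t0 where "(z0, t0) \<in> P"
    and "\<And>z t. (z, t) \<in> P \<Longrightarrow> t0 + z0 \<bullet> z0 \<le> t + z0 \<bullet> z"
proof -
  define f where "f p = snd p + fst p \<bullet> fst p / 2" for p :: "'b \<times> real"
  define m where "m = Inf (f ` P)"
  have bdd: "bdd_below (f ` P)"
    using bound by (force simp: f_def intro!: bdd_belowI[of _ c])
  have m_le: "m \<le> f p" if "p \<in> P" for p
    unfolding m_def using bdd that by (intro cInf_lower) auto
  have seg: "(1 - s) *\<^sub>R p + s *\<^sub>R q \<in> P" if "p \<in> P" "q \<in> P" "0 \<le> s" "s \<le> 1" for p q s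
    using convexD[OF \<open>convex P\<close>, of p q "1 - s" s] that by simp
  \<comment> \<open>Strong convexity of \<open>f\<close> in its first component, as an exact
    identity along segments.\<close>
  have f_seg: "f ((1 - s) *\<^sub>R p + s *\<^sub>R q) =
      (1 - s) * f p + s * f q - s * (1 - s) / 2 * ((fst p - fst q) \<bullet> (fst p - fst q))" for s p q
    by (simp add: f_def inner_diff inner_add inner_commute field_simps power2_eq_square)
  \<comment> \<open>The value at the midpoint is at least \<open>m\<close>, so near-minimisers have
    nearby first components; this makes a minimising sequence Cauchy there.\<close>
  have gap: "(norm (fst p - fst q))\<^sup>2 \<le> 4 * (f p + f q - 2 * m)" if "p \<in> P" "q \<in> P" for p q
    using m_le[OF seg[OF that, of "1/2"]] f_seg[of "1/2" p q]
    by (simp add: power2_norm_eq_inner)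
  have "\<exists>p\<in>P. f p < m + 1 / real (Suc n)" for n
    using cInf_lessD[of "f ` P" "m + 1 / real (Suc n)"] \<open>P \<noteq> {}\<close> by (auto simp: m_def)
  then obtain p where p: "p n \<in> P" "f (p n) < m + 1 / real (Suc n)" for n by metis
  have inv: "(\<lambda>n. 1 / real (Suc n)) \<longlonglongrightarrow> 0"
    using LIMSEQ_inverse_real_of_nat by (simp add: inverse_eq_divide)
  have f_lim: "(\<lambda>n. f (p n)) \<longlonglongrightarrow> m"
  proof (rule tendsto_sandwich[OF _ _ tendsto_const])
    show "(\<lambda>n. m + 1 / real (Suc n)) \<longlonglongrightarrow> m"
      using tendsto_add[OF tendsto_const inv, of m] by simp
  qed (use p m_le in \<open>auto intro!: always_eventually less_imp_le simp del: of_nat_Suc\<close>)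
  have "Cauchy (\<lambda>n. fst (p n))"
  proof (rule metric_CauchyI)
    fix e :: real assume "0 < e"
    \<comment> \<open>Two errors below \<open>e\<^sup>2 / 8\<close>, multiplied by the factor 4 in
      \<open>gap\<close>, stay below \<open>e\<^sup>2\<close>.\<close>
    then have "0 < e\<^sup>2 / 8" by simp
    then obtain N where N: "\<And>n. n \<ge> N \<Longrightarrow> f (p n) < m + e\<^sup>2 / 8"
      using order_tendstoD(2)[OF f_lim, of "m + e\<^sup>2 / 8"]
      by (auto simp: eventually_sequentially)
    have "dist (fst (p i)) (fst (p j)) < e" if "i \<ge> N" "j \<ge> N" for i j
    proof (rule power2_less_imp_less)
      show "(dist (fst (p i)) (fst (p j)))\<^sup>2 < e\<^sup>2"
        using gap[OF p(1)[of i] p(1)[of j]] N[OF that(1)] N[OF that(2)]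
        by (simp add: dist_norm field_simps)
    qed (use \<open>0 < e\<close> in simp)
    then show "\<exists>M. \<forall>i\<ge>M. \<forall>j\<ge>M. dist (fst (p i)) (fst (p j)) < e" by blast
  qed
  then obtain z0 where z0: "(\<lambda>n. fst (p n)) \<longlonglongrightarrow> z0"
    using Cauchy_convergent_iff convergent_def by blast
  \<comment> \<open>The height at which \<open>f (z0, t0) = m\<close>.\<close>
  define t0 where "t0 = m - z0 \<bullet> z0 / 2"
  have "(\<lambda>n. f (p n) - fst (p n) \<bullet> fst (p n) / 2) \<longlonglongrightarrow> t0"
    unfolding t0_def by (intro tendsto_intros f_lim z0) simp
  then have "(\<lambda>n. snd (p n)) \<longlonglongrightarrow> t0" by (simp add: f_def)
  with z0 have "p \<longlonglongrightarrow> (z0, t0)" using tendsto_Pair by fastforce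
  then have in_P: "(z0, t0) \<in> P"
    using \<open>closed P\<close> p(1) closed_sequentially by blast
  have "t0 + z0 \<bullet> z0 \<le> t + z0 \<bullet> z" if q: "(z, t) \<in> P" for z t
  proof (rule ccontr)
    \<comment> \<open>\<open>b\<close> is the derivative of \<open>f\<close> at
      \<open>(z0, t0)\<close> towards \<open>(z, t)\<close>. If it is negative, a step
      \<open>s\<close> short enough to control the quadratic term \<open>s * D / 2\<close> takes
      \<open>f\<close> below \<open>m\<close>.\<close>
    define b where "b = t + z0 \<bullet> z - t0 - z0 \<bullet> z0"
    define D where "D = (z - z0) \<bullet> (z - z0)"
    assume "\<not> ?thesis"
    then have "b < 0" by (simp add: b_def)
    have "D \<ge> 0" by (simp add: D_def)
    define s where "s = min 1 (- b / (D + 1))"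
    have s: "0 < s" "s \<le> 1"
      using \<open>b < 0\<close> \<open>D \<ge> 0\<close> by (auto simp: s_def divide_neg_pos)
    have "s \<le> - b / (D + 1)" by (simp add: s_def)
    then have s_D: "s * (D + 1) \<le> - b"
      using \<open>D \<ge> 0\<close> by (simp only: pos_le_divide_eq)
    have "m \<le> f ((1 - s) *\<^sub>R (z0, t0) + s *\<^sub>R (z, t))"
      using m_le[OF seg[OF in_P q]] s by simp
    also have "\<dots> = m + s * (b + s * D / 2)"
      by (simp add: f_def b_def D_def t0_def inner_diff inner_add inner_commute field_simps
          power2_eq_square)
    finally have "0 \<le> b + s * D / 2" using s by (simp add: zero_le_mult_iff)
    moreover have "s * D \<ge> 0" using s \<open>D \<ge> 0\<close> by simp
    ultimately show False using s s_D \<open>b < 0\<close> by (simp add: distrib_left)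
  qed
  with in_P show ?thesis using that by blast
qed

section \<open>Minty's theorem and the resolvent\<close>

text \<open>This is surjectivity of \<open>Id + A\<close> at the single value 0. Working with a bare
  set of pairs lets every other value be reached by translating the graph.\<close>

lemma maximal_monotone_set_meets_antidiagonal:
  fixes G :: "('a::{real_inner, complete_space} \<times> 'a) set"
  assumes mono: "\<And>x u y v. (x, u) \<in> G \<Longrightarrow> (y, v) \<in> G \<Longrightarrow> (x - y) \<bullet> (u - v) \<ge> 0"
    and maximal: "\<And>x u. (\<And>y v. (y, v) \<in> G \<Longrightarrow> (x - y) \<bullet> (u - v) \<ge> 0) \<Longrightarrow> (x, u) \<in> G"
  shows "\<exists>x. (x, - x) \<in> G"
proof -
  \<comment> \<open>The epigraph of the Fitzpatrick function of \<open>G\<close>, as an intersection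
    of half-spaces, which makes it closed and convex.\<close>
  define P where "P = (\<Inter>(a, v)\<in>G. {(z, t). (v, a) \<bullet> z - a \<bullet> v \<le> t})"
  have in_P: "((x, u), t) \<in> P \<longleftrightarrow> (\<forall>a v. (a, v) \<in> G \<longrightarrow> x \<bullet> v + a \<bullet> u - a \<bullet> v \<le> t)" for x u t
    by (auto simp: P_def inner_commute)
  have epi_eq: "{(z, t). (v, a) \<bullet> z - a \<bullet> v \<le> t} = {p. ((v, a), - 1) \<bullet> p \<le> a \<bullet> v}" for a v :: 'a
    by auto
  have "closed P"
    unfolding P_def epi_eq by (auto intro!: closed_INT closed_halfspace_le)
  have "convex P"
    unfolding P_def epi_eq by (auto intro!: convex_INT convex_halfspace_le)
  have G_P: "((x, u), x \<bullet> u) \<in> P" if "(x, u) \<in> G" for x u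
    using mono[OF that] unfolding in_P by (force simp: inner_diff inner_commute)
  have duality: "x \<bullet> u \<le> t" if "((x, u), t) \<in> P" for x u t
  proof (rule ccontr)
    assume less: "\<not> x \<bullet> u \<le> t"
    have *: "x \<bullet> v + a \<bullet> u - a \<bullet> v \<le> t" if "(a, v) \<in> G" for a v
      using \<open>((x, u), t) \<in> P\<close> that in_P by blast
    \<comment> \<open>If \<open>t\<close> is below \<open>x \<bullet> u\<close>, then
      \<open>(x, u)\<close> is monotonically related to all of \<open>G\<close> and so belongs to
      it; its own half-space then forces \<open>x \<bullet> u \<le> t\<close>.\<close>
    have "(x, u) \<in> G"
    proof (rule maximal)
      fix a v assume "(a, v) \<in> G"
      from *[OF this] less show "(x - a) \<bullet> (u - v) \<ge> 0" by (simp add: inner_diff)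
    qed
    from *[OF this] less show False by simp
  qed
  have bound: "0 \<le> t + z \<bullet> z / 2" if "(z, t) \<in> P" for z t
  proof -
    obtain x u where z: "z = (x, u)" by fastforce
    have "0 \<le> (x + u) \<bullet> (x + u)" by simp
    then have "- (x \<bullet> u) \<le> z \<bullet> z / 2"
      by (simp add: z inner_add inner_commute)
    moreover have "x \<bullet> u \<le> t" using duality that z by blast
    ultimately show ?thesis by linarith
  qed
  have "G \<noteq> {}" using maximal by blast
  then have "P \<noteq> {}" using G_P by fastforce
  from epigraph_quadratic_minimiser[OF \<open>closed P\<close> \<open>convex P\<close> this bound]
  obtain z0 t0 where z0t0: "(z0, t0) \<in> P"
    and opt: "\<And>z t. (z, t) \<in> P \<Longrightarrow> t0 + z0 \<bullet> z0 \<le> t + z0 \<bullet> z" by blast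
  obtain x u where z0: "z0 = (x, u)" by fastforce
  have "x \<bullet> u \<le> t0" using duality z0t0 z0 by blast
  \<comment> \<open>Optimality is tested at \<open>((a, v), a \<bullet> v)\<close>. With
    \<open>t0\<close> replaced by its lower bound \<open>x \<bullet> u\<close>, adding
    \<open>x \<bullet> u\<close> to both sides completes the square on the left and factors the
    right.\<close>
  then have key: "(x + u) \<bullet> (x + u) \<le> (- u - a) \<bullet> (- x - v)" if "(a, v) \<in> G" for a v
    using opt[OF G_P[OF that]] by (simp add: z0 inner_diff inner_add inner_commute)
  have "(- u, - x) \<in> G"
  proof (rule maximal)
    fix a v assume "(a, v) \<in> G"
    then show "(- u - a) \<bullet> (- x - v) \<ge> 0" using key inner_ge_zero order_trans by blast
  qed
  \<comment> \<open>At \<open>(a, v) = (- u, - x)\<close> the right side of \<open>key\<close>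
    vanishes.\<close>
  moreover from key[OF this] have "x + u = 0"
    by (metis diff_self inner_zero_left inner_ge_zero inner_eq_zero_iff antisym)
  then have "- u = x" by (simp add: add_eq_0_iff2)
  ultimately show ?thesis by auto
qed

text \<open>Otherwise adjoining \<open>(x, u)\<close> to the graph would give a proper monotone
  extension.\<close>

lemma maximally_monotone_opD:
  assumes "maximally_monotone_op A"
    and "\<And>y v. v \<in> A y \<Longrightarrow> (x - y) \<bullet> (u - v) \<ge> 0"
  shows "u \<in> A x"
proof (rule ccontr)
  assume "u \<notin> A x"
  let ?B = "A(x := insert u (A x))"
  have "monotone_op ?B"
    unfolding monotone_op_def gr_def
  proof (clarify)
    fix y v z w assume "v \<in> ?B y" "w \<in> ?B z"
    then consider "v \<in> A y" "w \<in> A z" | "y = x" "v = u" "w \<in> A z"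
      | "z = x" "w = u" "v \<in> A y" | "y = x" "z = x"
      by (auto split: if_splits)
    then show "(y - z) \<bullet> (v - w) \<ge> 0"
    proof cases
      case 1
      then show ?thesis
        using assms(1) by (auto simp: maximally_monotone_op_def monotone_op_def gr_def)
    next
      case 3
      with assms(2)[of v y] show ?thesis by (simp add: inner_diff)
    qed (use assms(2) in auto)
  qed
  moreover have "gr A \<subset> gr ?B"
    using \<open>u \<notin> A x\<close> by (auto simp: gr_def split: if_splits)
  ultimately show False using assms(1) by (auto simp: maximally_monotone_op_def)
qed

theorem Minty:
  fixes A :: "'a::{real_inner, complete_space} \<Rightarrow> 'a set"
  assumes "maximally_monotone_op A"
  shows "\<exists>x. w - x \<in> A x"
proof -
  have "\<exists>x. (x, - x) \<in> {(x, u). u + w \<in> A x}"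
  proof (rule maximal_monotone_set_meets_antidiagonal)
    fix x u y v assume "(x, u) \<in> {(x, u). u + w \<in> A x}" "(y, v) \<in> {(x, u). u + w \<in> A x}"
    then have "(x - y) \<bullet> ((u + w) - (v + w)) \<ge> 0"
      using assms unfolding maximally_monotone_op_def monotone_op_def gr_def by blast
    then show "(x - y) \<bullet> (u - v) \<ge> 0" by simp
  next
    fix x u assume *: "\<And>y v. (y, v) \<in> {(x, u). u + w \<in> A x} \<Longrightarrow> (x - y) \<bullet> (u - v) \<ge> 0"
    have "u + w \<in> A x"
    proof (rule maximally_monotone_opD[OF assms])
      fix y v assume "v \<in> A y"
      then show "(x - y) \<bullet> (u + w - v) \<ge> 0"
        using *[of y "v - w"] by (simp add: algebra_simps)
    qed
    then show "(x, u) \<in> {(x, u). u + w \<in> A x}" by simp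
  qed
  then show ?thesis by auto
qed

text \<open>\<open>the_elem\<close> is meaningful here because the preimage is a singleton: Minty's
  theorem gives existence, monotonicity gives uniqueness.\<close>

lemma resolvent_mem:
  fixes A :: "'a::{real_inner, complete_space} \<Rightarrow> 'a set"
  assumes "maximally_monotone_op A"
  shows "x - resolvent A x \<in> A (resolvent A x)"
proof -
  obtain y where y: "x - y \<in> A y" using Minty[OF assms] by blast
  have inv: "inverse_op (sum_op id_op A) x = {z. x - z \<in> A z}"
    by (force simp: inverse_op_def sum_op_def id_op_def)
  have "z = y" if "x - z \<in> A z" for z
  proof -
    have "(z - y) \<bullet> ((x - z) - (x - y)) \<ge> 0"
      using assms that y unfolding maximally_monotone_op_def monotone_op_def gr_def by blast
    moreover have "(x - z) - (x - y) = - (z - y)" by simp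
    ultimately have "(z - y) \<bullet> (z - y) \<le> 0" by (simp only: inner_minus_right)
    then show ?thesis by (metis inner_ge_zero inner_eq_zero_iff antisym right_minus_eq)
  qed
  with y have "{z. x - z \<in> A z} = {y}" by blast
  with y show ?thesis unfolding resolvent_def inv by simp
qed

section \<open>Reflected resolvents\<close>

abbreviation (input) reflection :: "('a::real_vector \<Rightarrow> 'a) \<Rightarrow> 'a \<Rightarrow> 'a" where
  "reflection J x \<equiv> 2 *\<^sub>R J x - x"

lemma norm_reflection_diff:
  fixes J :: "'a::real_inner \<Rightarrow> 'a"
  shows "(norm (reflection J x - reflection J y))\<^sup>2 =
    (norm (x - y))\<^sup>2 - 4 * ((J x - J y) \<bullet> ((x - J x) - (y - J y)))"
  by (simp add: power2_norm_eq_inner inner_diff inner_add inner_commute algebra_simps)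

lemma reflected_resolvent_nonexpansive:
  fixes A :: "'a::{real_inner, complete_space} \<Rightarrow> 'a set"
  assumes "maximally_monotone_op A"
  shows "norm (reflection (resolvent A) x - reflection (resolvent A) y) \<le> norm (x - y)"
proof (rule power2_le_imp_le)
  have "(resolvent A x - resolvent A y) \<bullet> ((x - resolvent A x) - (y - resolvent A y)) \<ge> 0"
    using assms resolvent_mem[OF assms]
    unfolding maximally_monotone_op_def monotone_op_def gr_def by blast
  then show "(norm (reflection (resolvent A) x - reflection (resolvent A) y))\<^sup>2 \<le> (norm (x - y))\<^sup>2"
    unfolding norm_reflection_diff by simp
qed simp

lemma reflected_resolvent_strictly_nonexpansive:
  fixes A :: "'a::{real_inner, complete_space} \<Rightarrow> 'a set"
  assumes "maximally_monotone_op A" "at_most_single_valued A" "strictly_monotone_op A"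
  shows "strictly_nonexpansive (reflection (resolvent A))"
  unfolding strictly_nonexpansive_def
proof (intro allI impI)
  fix x y :: 'a assume "x \<noteq> y"
  note mem = resolvent_mem[OF assms(1)]
  \<comment> \<open>Strict monotonicity needs distinct base points. Single-valuedness supplies them:
    a common resolvent value would have the same image under \<open>A\<close>, hence come from the
    same point.\<close>
  have "resolvent A x \<noteq> resolvent A y"
  proof
    assume eq: "resolvent A x = resolvent A y"
    then have "x - resolvent A x = y - resolvent A y"
      using assms(2) mem[of x] mem[of y] unfolding at_most_single_valued_def by metis
    with eq \<open>x \<noteq> y\<close> show False by simp
  qed
  then have "(resolvent A x - resolvent A y) \<bullet> ((x - resolvent A x) - (y - resolvent A y)) > 0"
    using assms(3) mem unfolding strictly_monotone_op_def gr_def by blast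
  then have "(norm (reflection (resolvent A) x - reflection (resolvent A) y))\<^sup>2 < (norm (x - y))\<^sup>2"
    unfolding norm_reflection_diff by simp
  then show "norm (reflection (resolvent A) x - reflection (resolvent A) y) < norm (x - y)"
    by (rule power2_less_imp_less) simp
qed

section \<open>Composition, averaging and fixed points\<close>

lemma strictly_nonexpansive_comp:
  fixes R S :: "'a::real_inner \<Rightarrow> 'a"
  assumes "\<And>x y. norm (R x - R y) \<le> norm (x - y)" "\<And>x y. norm (S x - S y) \<le> norm (x - y)"
    and "strictly_nonexpansive R \<or> strictly_nonexpansive S"
  shows "strictly_nonexpansive (R \<circ> S)"
  unfolding strictly_nonexpansive_def
proof (intro allI impI)
  fix x y :: 'a assume "x \<noteq> y"
  from assms(3) show "norm ((R \<circ> S) x - (R \<circ> S) y) < norm (x - y)"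
  proof
    assume "strictly_nonexpansive R"
    \<comment> \<open>\<open>S\<close> may merge \<open>x\<close> and \<open>y\<close>; the left
      side is then 0, still below the positive \<open>norm (x - y)\<close>.\<close>
    then show ?thesis
      using \<open>x \<noteq> y\<close> assms(2)[of x y] unfolding strictly_nonexpansive_def
      by (cases "S x = S y") (auto intro: less_le_trans)
  next
    assume "strictly_nonexpansive S"
    then show ?thesis
      using \<open>x \<noteq> y\<close> assms(1)[of "S x" "S y"] unfolding strictly_nonexpansive_def
      by (auto intro: le_less_trans)
  qed
qed

lemma average_firmly_nonexpansive:
  fixes N :: "'a::real_inner \<Rightarrow> 'a"
  assumes "\<And>x y. norm (N x - N y) \<le> norm (x - y)"
  shows "firmly_nonexpansive (\<lambda>x. (1/2) *\<^sub>R N x + (1/2) *\<^sub>R x)"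
  unfolding firmly_nonexpansive_def
proof (intro allI)
  fix x y :: 'a
  let ?T = "\<lambda>x. (1/2) *\<^sub>R N x + (1/2) *\<^sub>R x"
  \<comment> \<open>The parallelogram law: the two differences are half the sum and half the
    difference of \<open>x - y\<close> and \<open>N x - N y\<close>.\<close>
  have "(norm (?T x - ?T y))\<^sup>2 + (norm ((x - ?T x) - (y - ?T y)))\<^sup>2
      = ((norm (N x - N y))\<^sup>2 + (norm (x - y))\<^sup>2) / 2"
    by (simp add: power2_norm_eq_inner inner_diff inner_add inner_commute field_simps)
  also have "\<dots> \<le> (norm (x - y))\<^sup>2"
    using power_mono[OF assms[of x y], of 2] by simp
  finally show "(norm (?T x - ?T y))\<^sup>2 + (norm ((x - ?T x) - (y - ?T y)))\<^sup>2 \<le> (norm (x - y))\<^sup>2" .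
qed

lemma average_strictly_nonexpansive:
  fixes N :: "'a::real_inner \<Rightarrow> 'a"
  assumes "strictly_nonexpansive N"
  shows "strictly_nonexpansive (\<lambda>x. (1/2) *\<^sub>R N x + (1/2) *\<^sub>R x)"
  unfolding strictly_nonexpansive_def
proof (intro allI impI)
  fix x y :: 'a assume "x \<noteq> y"
  have "norm (((1/2) *\<^sub>R N x + (1/2) *\<^sub>R x) - ((1/2) *\<^sub>R N y + (1/2) *\<^sub>R y))
      = norm ((1/2) *\<^sub>R (N x - N y) + (1/2) *\<^sub>R (x - y))"
    by (simp add: algebra_simps)
  also have "\<dots> \<le> norm (N x - N y) / 2 + norm (x - y) / 2"
    by (rule order_trans[OF norm_triangle_ineq]) simp
  also have "\<dots> < norm (x - y)"
    using assms \<open>x \<noteq> y\<close> unfolding strictly_nonexpansive_def by fastforce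
  finally show "norm (((1/2) *\<^sub>R N x + (1/2) *\<^sub>R x) - ((1/2) *\<^sub>R N y + (1/2) *\<^sub>R y)) < norm (x - y)" .
qed

lemma strictly_nonexpansive_Fix:
  assumes "strictly_nonexpansive T"
  shows "Fix T = {} \<or> (\<exists>z. Fix T = {z})"
proof -
  have "x = y" if "x \<in> Fix T" "y \<in> Fix T" for x y
    using assms that unfolding strictly_nonexpansive_def Fix_def by force
  then show ?thesis by blast
qed

theorem corollary4p12:
  fixes A1 A2 :: "'a::{real_inner, complete_space} \<Rightarrow> 'a set"
    and T1 T2 T :: "'a \<Rightarrow> 'a"
  assumes "maximally_monotone_op A1"
    and "maximally_monotone_op A2"
    and "(at_most_single_valued A1 \<and> strictly_monotone_op A1) \<or>
         (at_most_single_valued A2 \<and> strictly_monotone_op A2)"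
    and "T1 = resolvent A1"
    and "T2 = resolvent A2"
    and "T = (\<lambda>x. (1/2) *\<^sub>R ((\<lambda>y. 2 *\<^sub>R T1 y - y) \<circ> (\<lambda>y. 2 *\<^sub>R T2 y - y)) x + (1/2) *\<^sub>R x)"
  shows "firmly_nonexpansive T \<and> strictly_nonexpansive T \<and>
         (Fix T = {} \<or> (\<exists>z. Fix T = {z}))"
proof -
  let ?N = "reflection T1 \<circ> reflection T2"
  have nonexp: "norm (reflection T1 x - reflection T1 y) \<le> norm (x - y)"
    "norm (reflection T2 x - reflection T2 y) \<le> norm (x - y)" for x y
    unfolding assms(4,5) using assms(1,2) reflected_resolvent_nonexpansive by blast+
  have "strictly_nonexpansive (reflection T1) \<or> strictly_nonexpansive (reflection T2)"
    unfolding assms(4,5)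
    using assms(1-3) reflected_resolvent_strictly_nonexpansive by blast
  then have strict: "strictly_nonexpansive ?N"
    by (rule strictly_nonexpansive_comp[OF nonexp])
  have "norm (?N x - ?N y) \<le> norm (x - y)" for x y
    using order_trans[OF nonexp(1) nonexp(2)] by simp
  then have "firmly_nonexpansive T"
    unfolding assms(6) by (rule average_firmly_nonexpansive)
  moreover have "strictly_nonexpansive T"
    unfolding assms(6) using strict by (rule average_strictly_nonexpansive)
  ultimately show ?thesis using strictly_nonexpansive_Fix by blast
qed

end
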